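(* For every integer $n\ge 1$ and every integer $k$, $$d_k(n+1)= d_{k-1}(n)+2d_k(n)-d_k(n-1).$$
   Context: A honeycomb strip of length $n$ consists of $n$ hexagons labelled $1,\dots,n$ in which hexagon $i$ is adjacent exactly with hexagons $i\pm1$ and $i\pm2$ (when these exist); equivalently its inner dual is the graph $P_n^2$ on vertices $1,\dots,n$ with $i\sim j$ iff $1\le|i-j|\le 2$. A division into $k$ pieces is a partition of the hexagons into $k$ blocks each inducing a connected subgraph of $P_n^2$. $d_k(n)$ denotes the number of such divisions of the strip of length $n$ into exactly $k$ pieces, for $n\ge1$; conventions: $d_k(n)=0$ for $k<1$ or $k>n$, and $d_1(0)=1$ (so $d_k(0)=0$ for $k\neq 1$). *)

theory Defs
  imports "HOL-Library.Disjoint_Sets" "Graph_Theory.Graph_Theory"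
begin

text \<open>The honeycomb strip, given by its inner dual graph $P_n^2$. An undirected edge is
  a pair of opposite arcs.\<close>

definition strip :: "nat \<Rightarrow> nat pair_pre_digraph" where
  "strip n = \<lparr> pverts = {1..n},
     parcs = {(i, j). i \<in> {1..n} \<and> j \<in> {1..n} \<and> 1 \<le> \<bar>int i - int j\<bar> \<and> \<bar>int i - int j\<bar> \<le> 2} \<rparr>"

lemma pair_graph_strip: "pair_graph (strip n)"
proof
  show "finite (pverts (strip n))" by (simp add: strip_def)
  show "finite (parcs (strip n))"
    by (rule finite_subset[of _ "{1..n} \<times> {1..n}"]) (auto simp: strip_def)
  show "symmetric (with_proj (strip n))"
    by (auto simp: strip_def symmetric_def sym_def arcs_ends_conv)
qed (auto simp: strip_def)

text \<open>Here \<open>connected\<close> is connectedness of graphs, qualified because the same name also denotes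
  topological connectedness.\<close>

definition divisions :: "int \<Rightarrow> nat \<Rightarrow> nat set set set" where
  "divisions k n = {P. partition_on {1..n} P \<and> int (card P) = k \<and>
     (\<forall>B\<in>P. Digraph_Component.connected (with_proj (strip n) \<restriction> B))}"

text \<open>The value at \<open>n = 0\<close> is a convention and differs from \<open>card (divisions k 0)\<close>: the empty
  strip has the empty partition, with no pieces, as its only division.\<close>

definition d :: "int \<Rightarrow> nat \<Rightarrow> int" where
  "d k n = (if n = 0 then (if k = 1 then 1 else 0) else int (card (divisions k n)))"

lemma finite_divisions: "finite (divisions k n)"
  by (rule finite_subset[of _ "Pow (Pow {1..n})"]) (auto simp: divisions_def partition_on_def)

lemma card_partition_on_le:
  assumes "finite A" "partition_on A P"
  shows "card P \<le> card A"
proof -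
  have fin: "finite P" using assms finite_elements by blast
  have "card P = (\<Sum>B\<in>P. 1)" by simp
  also have "\<dots> \<le> (\<Sum>B\<in>P. card B)"
  proof (rule sum_mono)
    fix B assume B: "B \<in> P"
    with assms have "finite B" "B \<noteq> {}"
      by (auto simp: partition_on_def intro: finite_subset)
    then show "1 \<le> card B" by (simp add: Suc_le_eq card_gt_0_iff)
  qed
  also have "\<dots> = card (\<Union>P)"
    using assms by (intro card_Union_disjoint[symmetric])
      (auto simp: partition_on_def disjoint_def pairwise_def disjnt_def intro: finite_subset)
  finally show ?thesis using assms by (simp add: partition_on_def)
qed

lemma d_eq_0:
  assumes "n \<ge> 1" "k < 1 \<or> k > int n"
  shows "d k n = 0"
proof -
  have "divisions k n = {}"
  proof (rule equals0I)
    fix P assume P: "P \<in> divisions k n"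
    then have part: "partition_on {1..n} P" and c: "int (card P) = k"
      by (auto simp: divisions_def)
    have "card P \<le> n" using card_partition_on_le[OF _ part] by simp
    moreover have "P \<noteq> {}" using part assms by (auto simp: partition_on_def)
    moreover have "finite P" using part finite_elements by blast
    ultimately show False using assms c by (auto simp: card_gt_0_iff[symmetric])
  qed
  then show ?thesis using assms by (simp add: d_def)
qed

end

theory Submission
  imports Defs
begin

text \<open>A nonempty set of hexagons is connected iff it has no gap of two or more missing hexagons. Hence the
  hexagon \<open>n + 1\<close> is either alone in its piece, or in one piece with \<open>n\<close> or with \<open>n - 1\<close>. Deleting it
  leaves a division of the strip of length \<open>n\<close>: the three cases account for \<open>d (k - 1) n\<close>, \<open>d k n\<close>
  and \<open>d k n\<close> divisions. The last two overlap in the divisions with \<open>n - 1\<close>, \<open>n\<close> and \<open>n + 1\<close>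
  in one piece; deleting both \<open>n + 1\<close> and \<open>n\<close> from these shows that there are \<open>d k (n - 1)\<close> of them.
  For \<open>n = 1\<close> the third case is void, and the convention at \<open>0\<close> makes \<open>d k 1 - d k 0\<close> vanish.\<close>

section \<open>Connected sets of hexagons\<close>

text \<open>The element \<open>y\<close> only witnesses that \<open>x\<close> is not the greatest
  element of \<open>B\<close>. This form of connectedness mentions neither paths nor
  \<open>n\<close>, so it carries over between strips of different lengths.\<close>

definition gapfree :: "nat set \<Rightarrow> bool" where
  "gapfree B \<longleftrightarrow> (\<forall>x\<in>B. \<forall>y\<in>B. x < y \<longrightarrow> x + 1 \<in> B \<or> x + 2 \<in> B)"

definition close_pairs :: "nat set \<Rightarrow> (nat \<times> nat) set" where
  "close_pairs B = {(i, j). i \<in> B \<and> j \<in> B \<and> 1 \<le> \<bar>int i - int j\<bar> \<and> \<bar>int i - int j\<bar> \<le> 2}"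

lemma sym_close_pairs: "sym (close_pairs B)"
  by (auto simp: sym_def close_pairs_def)

text \<open>The library's connectedness is strong connectedness of the symmetrised graph, which
  includes nonemptiness, with reachability given by \<open>rtrancl_on\<close>. The arcs here are
  symmetric already and have both ends in \<open>B\<close>, so between points of \<open>B\<close>
  the plain closure gives the same relation.\<close>

lemma connected_strip_iff_rtrancl:
  assumes "B \<subseteq> {1..n}"
  shows "Digraph_Component.connected (with_proj (strip n) \<restriction> B) \<longleftrightarrow>
    B \<noteq> {} \<and> (\<forall>x\<in>B. \<forall>y\<in>B. (x, y) \<in> (close_pairs B)\<^sup>*)"
proof -
  let ?G = "mk_symmetric (with_proj (strip n) \<restriction> B)"
  have arcs: "parcs ?G = close_pairs B"
  proof (intro equalityI subrelI)
    fix x y assume "(x, y) \<in> close_pairs B"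
    then have "(x, y) \<in> arcs (with_proj (strip n) \<restriction> B)"
      using assms by (auto simp: strip_def close_pairs_def)
    then show "(x, y) \<in> parcs ?G"
      by (force simp: mk_symmetric_def)
  qed (auto simp: mk_symmetric_def strip_def close_pairs_def)
  have verts: "pverts ?G = B"
    by (simp add: mk_symmetric_def)
  have "rtrancl_on B (close_pairs B) = (close_pairs B)\<^sup>* \<inter> B \<times> B"
  proof (intro equalityI subrelI)
    fix x y assume "(x, y) \<in> rtrancl_on B (close_pairs B)"
    then show "(x, y) \<in> (close_pairs B)\<^sup>* \<inter> B \<times> B"
      by induction (auto intro: rtrancl.rtrancl_into_rtrancl)
  next
    fix x y assume "(x, y) \<in> (close_pairs B)\<^sup>* \<inter> B \<times> B"
    then have "(x, y) \<in> (close_pairs B)\<^sup>*" "x \<in> B" by auto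
    then show "(x, y) \<in> rtrancl_on B (close_pairs B)"
      by induction (auto simp: close_pairs_def intro: rtrancl_on_into_rtrancl_on)
  qed
  then show ?thesis
    unfolding connected_def strongly_connected_def reachable_def
    by (auto simp: arcs verts)
qed

lemma rtrancl_close_pairs_iff_gapfree:
  "(\<forall>x\<in>B. \<forall>y\<in>B. (x, y) \<in> (close_pairs B)\<^sup>*) \<longleftrightarrow> gapfree B"
proof
  assume conn: "\<forall>x\<in>B. \<forall>y\<in>B. (x, y) \<in> (close_pairs B)\<^sup>*"
  show "gapfree B"
    unfolding gapfree_def
  proof (intro ballI impI, rule ccontr)
    fix x y assume "x \<in> B" "y \<in> B" "x < y" and gap: "\<not> (x + 1 \<in> B \<or> x + 2 \<in> B)"
    have "(x, y) \<in> (close_pairs B)\<^sup>*"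
      using conn \<open>x \<in> B\<close> \<open>y \<in> B\<close> by blast
    \<comment> \<open>Invariant along the path: steps have length at most 2, so without
      \<open>x + 1\<close> and \<open>x + 2\<close> a path from \<open>x\<close> never gets above
      \<open>x\<close>.\<close>
    then have "y \<le> x"
    proof induction
      case (step z w)
      then have "w \<in> B" "w \<le> x + 2"
        by (auto simp: close_pairs_def)
      moreover have "w \<noteq> x + 1" "w \<noteq> x + 2"
        using gap \<open>w \<in> B\<close> by auto
      ultimately show ?case by linarith
    qed simp
    then show False
      using \<open>x < y\<close> by simp
  qed
next
  assume gf: "gapfree B"
  have up: "(x, y) \<in> (close_pairs B)\<^sup>*" if "x \<in> B" "y \<in> B" "x \<le> y" for x y
    using that
  proof (induction "y - x" arbitrary: x rule: less_induct)
    case less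
    \<comment> \<open>The case \<open>y = x + 1\<close> is separate because \<open>gapfree\<close>
      might offer only \<open>x + 2\<close>, which overshoots \<open>y\<close>. From
      \<open>x + 2 \<le> y\<close> on, the next element is at most \<open>y\<close>.\<close>
    consider "x = y" | "y = x + 1" | "x + 2 \<le> y"
      using less.prems by linarith
    then show ?case
    proof cases
      case 2
      then have "(x, y) \<in> close_pairs B"
        using less.prems by (auto simp: close_pairs_def)
      then show ?thesis by blast
    next
      case 3
      then obtain z where z: "z \<in> B" "z = x + 1 \<or> z = x + 2"
        using gf less.prems unfolding gapfree_def by (metis add_2_eq_Suc' less_le_trans lessI less_Suc_eq)
      then have "(x, z) \<in> close_pairs B"
        using less.prems by (auto simp: close_pairs_def)
      moreover have "(z, y) \<in> (close_pairs B)\<^sup>*"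
        using less.hyps[of z] less.prems z 3 by auto
      ultimately show ?thesis
        by (rule converse_rtrancl_into_rtrancl)
    qed simp
  qed
  show "\<forall>x\<in>B. \<forall>y\<in>B. (x, y) \<in> (close_pairs B)\<^sup>*"
    using up sym_close_pairs[THEN sym_rtrancl] by (meson nat_le_linear symD)
qed

text \<open>Blocks of a partition are nonempty, so connectedness of a block reduces to
  \<open>gapfree\<close>, and the graph can be forgotten from here on.\<close>

lemma divisions_eq_gapfree:
  "divisions k n = {P. partition_on {1..n} P \<and> int (card P) = k \<and> (\<forall>B\<in>P. gapfree B)}"
proof -
  have "Digraph_Component.connected (with_proj (strip n) \<restriction> B) \<longleftrightarrow> gapfree B"
    if "partition_on {1..n} P" "B \<in> P" for P B
    using that connected_strip_iff_rtrancl[of B n] rtrancl_close_pairs_iff_gapfree[of B]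
    by (auto simp: partition_on_def)
  then show ?thesis
    unfolding divisions_def by blast
qed

lemma gapfree_singleton: "gapfree {x}"
  by (simp add: gapfree_def)

text \<open>The new greatest element is within distance 2 of \<open>m\<close>. Elements below
  \<open>m\<close> keep their old successors, and those from \<open>m\<close> on see
  \<open>Suc n\<close> itself.\<close>

lemma gapfree_insert_Suc:
  assumes "gapfree B" "B \<subseteq> {..n}" "m \<in> B" "n \<le> m + 1"
  shows "gapfree (insert (Suc n) B)"
  unfolding gapfree_def
proof (intro ballI impI)
  fix x y assume xy: "x \<in> insert (Suc n) B" "y \<in> insert (Suc n) B" "x < y"
  then have x: "x \<in> B"
    using assms(2) by auto
  show "x + 1 \<in> insert (Suc n) B \<or> x + 2 \<in> insert (Suc n) B"
  proof (cases "x < m \<or> y \<in> B")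
    case True
    then show ?thesis
      using assms(1,3) x xy(3) unfolding gapfree_def by blast
  next
    case False
    then have "Suc n = x + 1 \<or> Suc n = x + 2"
      using assms(2,4) x xy by auto
    then show ?thesis by auto
  qed
qed

lemma gapfree_remove_Suc:
  assumes "gapfree B" "B \<subseteq> {..Suc n}"
  shows "gapfree (B - {Suc n})"
  unfolding gapfree_def
proof (intro ballI impI)
  fix x y assume xy: "x \<in> B - {Suc n}" "y \<in> B - {Suc n}" "x < y"
  then have "x + 1 \<in> B \<or> x + 2 \<in> B" "y \<le> n"
    using assms unfolding gapfree_def by fastforce+
  then show "x + 1 \<in> B - {Suc n} \<or> x + 2 \<in> B - {Suc n}"
    \<comment> \<open>If \<open>y = x + 1\<close>, then \<open>y\<close> is the required element.
      Otherwise \<open>x + 2 \<le> y \<le> n\<close>, so neither candidate is the deleted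
      \<open>Suc n\<close>.\<close>
    using xy by (cases "y = x + 1") auto
qed

section \<open>Adding an element to a block of a partition\<close>

definition together :: "'a \<Rightarrow> 'a \<Rightarrow> 'a set set \<Rightarrow> bool" where
  "together a b P \<longleftrightarrow> (\<exists>B\<in>P. a \<in> B \<and> b \<in> B)"

definition join :: "'a \<Rightarrow> 'a \<Rightarrow> 'a set set \<Rightarrow> 'a set set" where
  "join x m P = (\<lambda>B. if m \<in> B then insert x B else B) ` P"

text \<open>If \<open>{x}\<close> is a block, the empty set remains and the result is no partition;
  hence the assumption \<open>together m x Q\<close> in \<open>partition_on_delete\<close>.\<close>

definition delete :: "'a \<Rightarrow> 'a set set \<Rightarrow> 'a set set" where
  "delete x Q = (\<lambda>C. C - {x}) ` Q"

lemma partition_on_same_block: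
  "partition_on A P \<Longrightarrow> B \<in> P \<Longrightarrow> C \<in> P \<Longrightarrow> x \<in> B \<Longrightarrow> x \<in> C \<Longrightarrow> B = C"
  by (auto simp: partition_on_def disjoint_def)

lemma delete_join:
  assumes "x \<notin> \<Union>P"
  shows "delete x (join x m P) = P"
proof -
  have "delete x (join x m P) = (\<lambda>B. B) ` P"
    unfolding delete_def join_def image_image using assms by (intro image_cong) auto
  then show ?thesis by simp
qed

text \<open>The element \<open>m\<close> survives the deletion and marks the block that
  \<open>x\<close> came from.\<close>

lemma join_delete:
  assumes "partition_on A Q" "together m x Q" "m \<noteq> x"
  shows "join x m (delete x Q) = Q"
proof -
  have "(if m \<in> C - {x} then insert x (C - {x}) else C - {x}) = C" if "C \<in> Q" for C
    using assms that partition_on_same_block[OF assms(1)] unfolding together_def by auto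
  then have "join x m (delete x Q) = (\<lambda>C. C) ` Q"
    unfolding delete_def join_def image_image by (intro image_cong) auto
  then show ?thesis by simp
qed

lemma together_join: "m \<in> \<Union>P \<Longrightarrow> together m x (join x m P)"
  by (auto simp: together_def join_def)

lemma partition_on_join:
  assumes "partition_on A P" "x \<notin> A" "m \<in> A"
  shows "partition_on (insert x A) (join x m P)"
proof (rule partition_onI)
  show "\<Union>(join x m P) = insert x A"
    using assms by (auto simp: join_def partition_on_def split: if_splits)
  show "{} \<notin> join x m P"
    using assms by (auto simp: join_def partition_on_def split: if_splits)
next
  fix p q assume "p \<in> join x m P" "q \<in> join x m P" "p \<noteq> q"
  then obtain B C where BC: "B \<in> P" "C \<in> P"
    and p: "p = (if m \<in> B then insert x B else B)" and q: "q = (if m \<in> C then insert x C else C)"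
    unfolding join_def by (elim imageE)
  then have ne: "B \<noteq> C"
    using \<open>p \<noteq> q\<close> by blast
  have "B \<inter> C = {}" "x \<notin> B" "x \<notin> C"
    using assms BC ne by (auto simp: partition_on_def disjoint_def)
  then show "disjnt p q"
    unfolding p q by (auto simp: disjnt_def)
qed

lemma partition_on_delete:
  assumes "partition_on (insert x A) Q" "x \<notin> A" "together m x Q" "m \<noteq> x"
  shows "partition_on A (delete x Q)"
proof (rule partition_onI)
  show "\<Union>(delete x Q) = A"
    using assms(1,2) by (auto simp: delete_def partition_on_def)
  have "C - {x} \<noteq> {}" if "C \<in> Q" for C
  proof
    assume "C - {x} = {}"
    then have "C = {x}"
      using partition_onD3[OF assms(1)] that by (metis Diff_eq_empty_iff subset_singletonD)
    moreover obtain B where "B \<in> Q" "m \<in> B" "x \<in> B"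
      using assms(3) by (auto simp: together_def)
    ultimately have "B = {x}"
      using partition_on_same_block[OF assms(1) _ that] by blast
    then show False
      using \<open>m \<in> B\<close> assms(4) by simp
  qed
  then show "{} \<notin> delete x Q"
    by (auto simp: delete_def)
next
  fix p q assume "p \<in> delete x Q" "q \<in> delete x Q" "p \<noteq> q"
  then show "disjnt p q"
    using assms(1) by (auto simp: delete_def partition_on_def disjoint_def disjnt_def)
qed

text \<open>Both \<open>join\<close> and \<open>delete\<close> are images, so neither increases the
  number of blocks, and \<open>delete\<close> leads back to \<open>P\<close>.\<close>

lemma card_join:
  assumes "finite P" "x \<notin> \<Union>P"
  shows "card (join x m P) = card P"
proof (rule antisym)
  show "card (join x m P) \<le> card P"
    unfolding join_def by (rule card_image_le) fact
  have "card (delete x (join x m P)) \<le> card (join x m P)"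
    unfolding delete_def by (rule card_image_le) (simp add: join_def assms(1))
  then show "card P \<le> card (join x m P)"
    by (simp only: delete_join[OF assms(2)])
qed

section \<open>Counting divisions\<close>

text \<open>The assumptions allow exactly \<open>m = n\<close> and \<open>m = n - 1\<close>, the
  latter only if it is an actual hexagon. These are the possible neighbours of \<open>Suc n\<close>,
  so joining it to the block of \<open>m\<close> keeps that block connected.\<close>

lemma bij_betw_join_divisions:
  assumes "m \<in> {1..n}" "n \<le> m + 1"
  shows "bij_betw (join (Suc n) m) (divisions k n)
    {Q \<in> divisions k (Suc n). together m (Suc n) Q}"
proof (rule bij_betw_byWitness[where f' = "delete (Suc n)"])
  have ins: "{1..Suc n} = insert (Suc n) {1..n}"
    by auto
  have new: "Suc n \<notin> \<Union>P" if "partition_on {1..n} P" for P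
    by (simp flip: partition_onD1[OF that])
  show "\<forall>P\<in>divisions k n. delete (Suc n) (join (Suc n) m P) = P"
    using new by (auto simp: divisions_eq_gapfree intro!: delete_join)
  show jd: "\<forall>Q\<in>{Q \<in> divisions k (Suc n). together m (Suc n) Q}. join (Suc n) m (delete (Suc n) Q) = Q"
  proof
    fix Q assume "Q \<in> {Q \<in> divisions k (Suc n). together m (Suc n) Q}"
    then have "partition_on {1..Suc n} Q" "together m (Suc n) Q"
      by (auto simp: divisions_def)
    then show "join (Suc n) m (delete (Suc n) Q) = Q"
      using assms(1) by (intro join_delete) auto
  qed
  show "join (Suc n) m ` divisions k n \<subseteq> {Q \<in> divisions k (Suc n). together m (Suc n) Q}"
  proof (rule image_subsetI)
    fix P assume "P \<in> divisions k n"
    then have P: "partition_on {1..n} P" "int (card P) = k" "\<forall>B\<in>P. gapfree B"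
      by (auto simp: divisions_eq_gapfree)
    have sub: "B \<subseteq> {..n}" if "B \<in> P" for B
      using that partition_onD1[OF P(1)] by auto
    have "\<forall>B\<in>join (Suc n) m P. gapfree B"
      using P(3) sub by (auto simp: join_def intro!: gapfree_insert_Suc[OF _ _ _ assms(2)])
    moreover have "partition_on {1..Suc n} (join (Suc n) m P)"
      unfolding ins using P(1) assms(1) by (intro partition_on_join) auto
    moreover have "card (join (Suc n) m P) = card P"
      using P(1) new by (intro card_join) (auto intro: finite_elements)
    moreover have "together m (Suc n) (join (Suc n) m P)"
      using assms(1) by (intro together_join) (simp flip: partition_onD1[OF P(1)])
    ultimately show "join (Suc n) m P \<in> {Q \<in> divisions k (Suc n). together m (Suc n) Q}"
      using P(2) by (simp add: divisions_eq_gapfree)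
  qed
  show "delete (Suc n) ` {Q \<in> divisions k (Suc n). together m (Suc n) Q} \<subseteq> divisions k n"
  proof (rule image_subsetI)
    fix Q assume Q': "Q \<in> {Q \<in> divisions k (Suc n). together m (Suc n) Q}"
    then have Q: "partition_on {1..Suc n} Q" "int (card Q) = k" "\<forall>B\<in>Q. gapfree B"
      "together m (Suc n) Q"
      by (auto simp: divisions_eq_gapfree)
    have sub: "B \<subseteq> {..Suc n}" if "B \<in> Q" for B
      using that partition_onD1[OF Q(1)] by auto
    have part: "partition_on {1..n} (delete (Suc n) Q)"
      using Q(1,4) assms(1) unfolding ins by (intro partition_on_delete) auto
    \<comment> \<open>Deletion might merge blocks a priori; the count is read off from
      \<open>card_join\<close>, since joining again restores \<open>Q\<close>.\<close>
    have "card (join (Suc n) m (delete (Suc n) Q)) = card (delete (Suc n) Q)"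
      using part new by (intro card_join) (auto intro: finite_elements)
    then have "card Q = card (delete (Suc n) Q)"
      using jd Q' by simp
    moreover have "\<forall>B\<in>delete (Suc n) Q. gapfree B"
      using Q(3) sub by (auto simp: delete_def intro: gapfree_remove_Suc)
    ultimately show "delete (Suc n) Q \<in> divisions k n"
      using Q(2) part by (simp add: divisions_eq_gapfree)
  qed
qed

lemma card_divisions_together:
  assumes "m \<in> {1..n}" "n \<le> m + 1"
  shows "card {Q \<in> divisions k (Suc n). together m (Suc n) Q} = card (divisions k n)"
  using bij_betw_same_card[OF bij_betw_join_divisions[OF assms]] by simp

lemma card_divisions_singleton:
  "card {Q \<in> divisions k (Suc n). {Suc n} \<in> Q} = card (divisions (k - 1) n)"
proof -
  have part: "partition_on {1..Suc n} (insert {Suc n} P) \<longleftrightarrow> partition_on {1..n} P"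
    if "Suc n \<notin> \<Union>P" for P
  proof -
    have "{1..Suc n} - {Suc n} = {1..n}" by auto
    then show ?thesis
      using partition_on_insert[of "{Suc n}" P "{1..Suc n}"] that by (simp add: disjnt_def)
  qed
  have new: "Suc n \<notin> \<Union>P" if "partition_on {1..n} P" for P
    by (simp flip: partition_onD1[OF that])
  have "bij_betw (insert {Suc n}) (divisions (k - 1) n) {Q \<in> divisions k (Suc n). {Suc n} \<in> Q}"
  proof (rule bij_betw_byWitness[where f' = "\<lambda>Q. Q - {{Suc n}}"])
    show "\<forall>P\<in>divisions (k - 1) n. insert {Suc n} P - {{Suc n}} = P"
    proof
      fix P assume "P \<in> divisions (k - 1) n"
      then have "Suc n \<notin> \<Union>P"
        by (intro new) (simp add: divisions_def)
      then show "insert {Suc n} P - {{Suc n}} = P"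
        by blast
    qed
    show "\<forall>Q\<in>{Q \<in> divisions k (Suc n). {Suc n} \<in> Q}. insert {Suc n} (Q - {{Suc n}}) = Q"
      by auto
    show "insert {Suc n} ` divisions (k - 1) n \<subseteq> {Q \<in> divisions k (Suc n). {Suc n} \<in> Q}"
    proof (rule image_subsetI)
      fix P assume "P \<in> divisions (k - 1) n"
      then have P: "partition_on {1..n} P" "int (card P) = k - 1" "\<forall>B\<in>P. gapfree B"
        by (auto simp: divisions_eq_gapfree)
      have "{Suc n} \<notin> P" "finite P"
        using new[OF P(1)] finite_elements[OF _ P(1)] by auto
      then show "insert {Suc n} P \<in> {Q \<in> divisions k (Suc n). {Suc n} \<in> Q}"
        using P part[OF new[OF P(1)]] by (simp add: divisions_eq_gapfree gapfree_singleton)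
    qed
    show "(\<lambda>Q. Q - {{Suc n}}) ` {Q \<in> divisions k (Suc n). {Suc n} \<in> Q} \<subseteq> divisions (k - 1) n"
    proof (rule image_subsetI)
      fix Q assume "Q \<in> {Q \<in> divisions k (Suc n). {Suc n} \<in> Q}"
      then have Q: "partition_on {1..Suc n} Q" "int (card Q) = k" "\<forall>B\<in>Q. gapfree B" "{Suc n} \<in> Q"
        by (auto simp: divisions_eq_gapfree)
      have "Suc n \<notin> \<Union>(Q - {{Suc n}})"
        using partition_on_same_block[OF Q(1) Q(4)] by auto
      then have "partition_on {1..n} (Q - {{Suc n}})"
        using part[of "Q - {{Suc n}}"] Q(1,4) by (simp add: insert_absorb)
      moreover have "int (card (Q - {{Suc n}})) = k - 1"
        using Q(2) card_Suc_Diff1[OF finite_elements[OF _ Q(1)] Q(4)] by simp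
      ultimately show "Q - {{Suc n}} \<in> divisions (k - 1) n"
        using Q(3) by (simp add: divisions_eq_gapfree)
    qed
  qed
  then show ?thesis
    by (rule bij_betw_same_card[symmetric])
qed

text \<open>The bijection is used twice: first the last hexagon is deleted with \<open>Suc n\<close>
  as marker, then \<open>Suc n\<close> is deleted with \<open>n\<close> as marker.\<close>

lemma card_divisions_together_both:
  assumes "n \<ge> 1"
  shows "card {Q \<in> divisions k (Suc (Suc n)). together (Suc n) (Suc (Suc n)) Q \<and>
    together n (Suc (Suc n)) Q} = card (divisions k n)" (is "card ?T = _")
proof -
  let ?j = "join (Suc (Suc n)) (Suc n)"
  have bij: "bij_betw ?j (divisions k (Suc n))
      {Q \<in> divisions k (Suc (Suc n)). together (Suc n) (Suc (Suc n)) Q}"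
    by (rule bij_betw_join_divisions) auto
  \<comment> \<open>The last hexagon enters the block of \<open>Suc n\<close>, so it meets
    \<open>n\<close> exactly when \<open>Suc n\<close> already did.\<close>
  have iff: "together n (Suc (Suc n)) (?j P) \<longleftrightarrow> together n (Suc n) P"
    if "P \<in> divisions k (Suc n)" for P
  proof -
    have "partition_on {1..Suc n} P"
      using that by (simp add: divisions_def)
    then have "Suc (Suc n) \<notin> \<Union>P"
      by (simp flip: partition_onD1)
    then show ?thesis
      by (auto simp: together_def join_def)
  qed
  have "?T = {Q \<in> ?j ` divisions k (Suc n). together n (Suc (Suc n)) Q}"
    unfolding bij_betw_imp_surj_on[OF bij] by auto
  also have "\<dots> = ?j ` {P \<in> divisions k (Suc n). together n (Suc n) P}"
    by (auto simp: iff)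
  finally have "?T = ?j ` {P \<in> divisions k (Suc n). together n (Suc n) P}" .
  moreover have "inj_on ?j {P \<in> divisions k (Suc n). together n (Suc n) P}"
    using bij_betw_imp_inj_on[OF bij] by (rule inj_on_subset) blast
  ultimately have "card ?T = card {P \<in> divisions k (Suc n). together n (Suc n) P}"
    by (simp only: card_image)
  also have "\<dots> = card (divisions k n)"
    using assms by (intro card_divisions_together) auto
  finally show ?thesis .
qed

text \<open>If the block of \<open>Suc n\<close> has other elements, let \<open>y\<close> be the
  greatest of them. Since \<open>y\<close> is not the last element of its block,
  \<open>gapfree\<close> puts \<open>y + 1\<close> or \<open>y + 2\<close> in the block, and by
  maximality of \<open>y\<close> that element is \<open>Suc n\<close>.\<close>

lemma divisions_Suc_cases:
  assumes "Q \<in> divisions k (Suc n)"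
  shows "{Suc n} \<in> Q \<or> together n (Suc n) Q \<or> together (n - 1) (Suc n) Q"
proof -
  have Q: "partition_on {1..Suc n} Q" "\<forall>B\<in>Q. gapfree B"
    using assms by (auto simp: divisions_eq_gapfree)
  have "Suc n \<in> \<Union>Q"
    unfolding partition_onD1[OF Q(1), symmetric] by simp
  then obtain C where C: "C \<in> Q" "Suc n \<in> C"
    by blast
  have sub: "C \<subseteq> {1..Suc n}"
    using C(1) partition_onD1[OF Q(1)] by auto
  show ?thesis
  proof (cases "C = {Suc n}")
    case True
    then show ?thesis using C by simp
  next
    case False
    define y where "y = Max (C - {Suc n})"
    have fin: "finite (C - {Suc n})"
      using sub by (meson finite_Diff finite_atLeastAtMost finite_subset)
    have ne: "C - {Suc n} \<noteq> {}"
      using False C(2) by auto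
    have y: "y \<in> C - {Suc n}"
      unfolding y_def using fin ne by (rule Max_in)
    have max: "z \<le> y" if "z \<in> C" "z \<noteq> Suc n" for z
      unfolding y_def using fin that by (intro Max_ge) auto
    have "y + 1 \<in> C \<or> y + 2 \<in> C"
      using Q(2) C y sub unfolding gapfree_def by fastforce
    then have "y + 1 = Suc n \<or> y + 2 = Suc n"
      using max[of "y + 1"] max[of "y + 2"] by auto
    then have "y = n \<or> y = n - 1"
      by auto
    then show ?thesis
      using y C by (auto simp: together_def)
  qed
qed

lemma singleton_not_together:
  "partition_on A Q \<Longrightarrow> {x} \<in> Q \<Longrightarrow> m \<noteq> x \<Longrightarrow> \<not> together m x Q"
  using partition_on_same_block by (fastforce simp: together_def)

text \<open>Inclusion-exclusion over the three cases, with the overlap moved to the left to avoid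
  subtraction on naturals. The count for \<open>n - 1\<close> stays unevaluated because for
  \<open>n = 1\<close> it would concern the nonexistent hexagon 0.\<close>

lemma card_divisions_Suc:
  assumes "n \<ge> 1"
  shows "card (divisions k (Suc n)) +
      card {Q \<in> divisions k (Suc n). together n (Suc n) Q \<and> together (n - 1) (Suc n) Q} =
    card (divisions (k - 1) n) + card (divisions k n) +
      card {Q \<in> divisions k (Suc n). together (n - 1) (Suc n) Q}"
proof -
  let ?S = "{Q \<in> divisions k (Suc n). {Suc n} \<in> Q}"
  let ?A = "{Q \<in> divisions k (Suc n). together n (Suc n) Q}"
  let ?B = "{Q \<in> divisions k (Suc n). together (n - 1) (Suc n) Q}"
  have fin: "finite {Q \<in> divisions k (Suc n). R Q}" for R
    by (rule finite_subset[OF _ finite_divisions]) auto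
  have "divisions k (Suc n) = ?S \<union> (?A \<union> ?B)"
    using divisions_Suc_cases by blast
  moreover have "?S \<inter> (?A \<union> ?B) = {}"
    using singleton_not_together by (fastforce simp: divisions_def)
  ultimately have "card (divisions k (Suc n)) = card ?S + card (?A \<union> ?B)"
    using card_Un_disjoint[of ?S "?A \<union> ?B"] fin by (metis finite_UnI)
  moreover have "card ?A + card ?B = card (?A \<union> ?B) + card (?A \<inter> ?B)"
    by (rule card_Un_Int) (rule fin)+
  moreover have "?A \<inter> ?B =
      {Q \<in> divisions k (Suc n). together n (Suc n) Q \<and> together (n - 1) (Suc n) Q}"
    by blast
  moreover have "card ?A = card (divisions k n)"
    using assms by (intro card_divisions_together) auto
  ultimately show ?thesis
    using card_divisions_singleton[of k n] by simp
qed

lemma divisions_one: "divisions k 1 = (if k = 1 then {{{1}}} else {})"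
proof -
  have single: "partition_on {1::nat} P \<longleftrightarrow> P = {{1}}" for P
  proof
    assume P: "partition_on {1} P"
    then have "B = {1}" if "B \<in> P" for B
      using partition_onD1[OF P] partition_onD3[OF P] that by (metis Union_upper subset_singletonD)
    moreover have "P \<noteq> {}"
      using partition_onD1[OF P] by auto
    ultimately show "P = {{1}}" by blast
  qed (simp add: partition_on_space)
  show ?thesis
    unfolding divisions_eq_gapfree atLeastAtMost_singleton single by (auto simp: gapfree_singleton)
qed

theorem theorem7:
  fixes n :: nat and k :: int
  assumes "n \<ge> 1"
  shows "d k (n + 1) = d (k - 1) n + 2 * d k n - d k (n - 1)"
proof (cases "n = 1")
  case True
  \<comment> \<open>This empties both sets involving \<open>n - 1 = 0\<close>. In the final step
    \<open>divisions_one\<close> identifies \<open>d k 1\<close> with the conventional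
    \<open>d k 0\<close>.\<close>
  have "\<not> together 0 2 Q" if "Q \<in> divisions k 2" for Q
    using that by (fastforce simp: divisions_def partition_on_def together_def)
  then have "card (divisions k 2) = card (divisions (k - 1) 1) + card (divisions k 1)"
    using card_divisions_Suc[of 1 k] by (simp add: numeral_2_eq_2 cong: conj_cong)
  then show ?thesis
    using True divisions_one[of k] by (simp add: d_def numeral_2_eq_2)
next
  case False
  then obtain m where n: "n = Suc m" and m: "m \<ge> 1"
    using assms by (cases n) auto
  \<comment> \<open>Now \<open>m = n - 1\<close> is an actual hexagon, so it can serve as a marker,
    and the overlap is counted by strips of length \<open>m\<close>.\<close>
  have "card {Q \<in> divisions k (Suc n). together m (Suc n) Q} = card (divisions k n)"
    using m n by (intro card_divisions_together) auto
  then have "card (divisions k (Suc n)) + card (divisions k m) =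
      card (divisions (k - 1) n) + 2 * card (divisions k n)"
    using card_divisions_Suc[OF assms, of k] card_divisions_together_both[OF m, of k]
    by (simp add: n)
  then have "int (card (divisions k (Suc n))) + int (card (divisions k m)) =
      int (card (divisions (k - 1) n)) + 2 * int (card (divisions k n))"
    by linarith
  then show ?thesis
    using m n by (simp add: d_def)
qed

end
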